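(* Fix $0<\tau<1$. Let $y_i=\theta^*_i+\epsilon_i$, $1\le i\le n$, where $\theta^*\in\mathbb{R}^n$ is piecewise constant with $K$ pieces of lengths $m_1,\dots,m_K$ (see context) and $\epsilon_1,\dots,\epsilon_n$ are i.i.d. with CDF $F$ such that $F(0)=\tau$ and there is a constant $L>0$ with $|F(x)-F(0)|\ge L|x|$ for all $x\in[-1,1]$. Let $\rho(x)=\tau|x|$ for $x\ge0$ and $\rho(x)=(1-\tau)|x|$ for $x<0$, and let $$\hat\theta=\arg\min_{\theta\in\mathbb{R}^n}\ \sum_{i=1}^n\rho(y_i-\theta_i)+\lambda\sum_{i=1}^{n-1}|\theta_i-\theta_{i+1}|.$$ Let $m_{\min}=\min_{1\le k\le K}m_k$ and $V=\max_{1\le i\le n}\theta^*_i-\min_{1\le i\le n}\theta^*_i$. Let $\delta\in(0,(\log2/e)^2)$ and assume $$m_{\min}\ge\frac{18}{L^2}\log\frac n\delta,\qquad \frac{3\big(2\log\log(2n)+\log\frac n\delta\big)}{L}\le\lambda\le\frac{L}{12}m_{\min}.$$ Then, with probability at least $1-4\big(1+\tfrac{24}{(\log2)^2}\big)\delta$, $$\begin{aligned}\sum_{i=1}^n|\hat\theta_i-\theta^*_i|^2\le{}&\frac{24}{L^2}\Big(2\log\log(2n)+\log\frac n\delta\Big)\Big(K+\sum_{k=1}^K\log\frac{m_k}{2}\Big)+\frac{3n}{L^2}\cdot\frac{4\big((\log\log(2n))^2+(\log\frac n\delta)^2\big)}{\lambda^2}\\&+\frac{6K}{L^2}\log\frac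 n\delta+\frac{24\lambda^2}{L^2}\sum_{k=1}^K\frac1{m_k}+2K\max\Big(3,\frac{12^4}{L^4},\frac{12^2}{2L^2}\log\frac n\delta\Big)V^2.\end{aligned}$$
   Context: $\theta^*$ is piecewise constant with $K$ pieces: there are integers $1=n_1<n_2<\cdots<n_K<n$, with the convention $n_{K+1}=n+1$, such that $\theta^*_{n_k}=\theta^*_{n_k+1}=\cdots=\theta^*_{n_{k+1}-1}$ for each $1\le k\le K$. The length of the $k$-th piece is $m_k=n_{k+1}-n_k$. $\arg\min$ denotes a minimizer; $\log$ is the natural logarithm. *)

theory Defs
  imports "HOL-Probability.Probability"
begin

text \<open>
  Vectors in \<open>\<real>\<^sup>n\<close> are functions \<open>nat \<Rightarrow> real\<close> of which only the values on \<open>{1..n}\<close> matter.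
\<close>

text \<open>
  The breakpoints \<open>\<nu> 1, \<dots>, \<nu> K\<close> are extended by \<open>\<nu> (K + 1) = n + 1\<close>. Values on adjacent
  pieces are not required to differ.
\<close>

definition piecewise_constant :: "nat \<Rightarrow> nat \<Rightarrow> (nat \<Rightarrow> nat) \<Rightarrow> (nat \<Rightarrow> real) \<Rightarrow> bool" where
  "piecewise_constant n K \<nu> \<theta> \<longleftrightarrow>
     1 \<le> K \<and> \<nu> 1 = 1 \<and> (\<forall>k\<in>{1..<K}. \<nu> k < \<nu> (k + 1)) \<and> \<nu> K < n \<and> \<nu> (K + 1) = n + 1 \<and>
     (\<forall>k\<in>{1..K}. \<forall>i\<in>{\<nu> k..<\<nu> (k + 1)}. \<theta> i = \<theta> (\<nu> k))"

definition piece_length :: "(nat \<Rightarrow> nat) \<Rightarrow> nat \<Rightarrow> nat" where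
  "piece_length \<nu> k = \<nu> (k + 1) - \<nu> k"

definition quantile_loss :: "real \<Rightarrow> real \<Rightarrow> real" where
  "quantile_loss \<tau> x = (if x \<ge> 0 then \<tau> * \<bar>x\<bar> else (1 - \<tau>) * \<bar>x\<bar>)"

definition fused_objective ::
    "real \<Rightarrow> real \<Rightarrow> nat \<Rightarrow> (nat \<Rightarrow> real) \<Rightarrow> (nat \<Rightarrow> real) \<Rightarrow> real" where
  "fused_objective \<tau> lam n y \<theta> =
     (\<Sum>i = 1..n. quantile_loss \<tau> (y i - \<theta> i)) + lam * (\<Sum>i = 1..n - 1. \<bar>\<theta> i - \<theta> (i + 1)\<bar>)"

end

theory Submission
  imports Defs
begin

text \<open>
  Suppose that a minimizer \<open>\<theta>\<close> exceeds a level \<open>c\<close> at \<open>i\<close>. Lowering it slightly on the run around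
  \<open>i\<close> where it exceeds \<open>c\<close>, cut off at the ends of a window of our choice, cannot improve the
  objective (\<open>superlevel_interval\<close>). This bounds the sum of \<open>1{y\<^sub>j \<le> c} - \<tau>\<close> over the run from above by a
  multiple of \<open>lam\<close> between \<open>-2\<close> and \<open>2\<close>, according to how many ends the run shares with the window.

  On a constant piece with \<open>c = \<theta>s\<^sub>i + x\<close> the summands are \<open>1{\<epsilon>\<^sub>j \<le> x} - \<tau>\<close>, whose mean \<open>F x - \<tau>\<close> is at
  least \<open>L * x\<close>. Up to fluctuations of order \<open>sqrt (length * ln (n / \<delta>))\<close>, uniformly over all runs
  (\<open>uniform_interval_deviation\<close>), the sum is therefore at least \<open>length * L * x\<close>. Comparing the two bounds
  excludes all runs unless \<open>x\<close> is small; the piece as the window yields an error of order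
  \<open>ln (n / \<delta>) / (L * lam) + sqrt (ln (n / \<delta>) / d) / L + lam / (L * m\<^sub>k)\<close> at distance \<open>d\<close> from the
  nearer end of the piece (\<open>minimizer_le_local\<close>). Errors from below follow by reflection.

  Close to the ends of a piece this radius exceeds \<open>1\<close>, where nothing is known about the growth of
  \<open>F\<close>. There all observations serve as the window, which bounds the error by \<open>V\<close> plus a small
  radius (\<open>minimizer_le_global\<close>); only order \<open>ln (n / \<delta>) / L\<^sup>2\<close> points per piece are affected.
  Squaring and summing the local radii (\<open>squared_error_le\<close>, \<open>piece_error_le\<close>) gives the terms of
  the stated bound, the harmonic sum over \<open>1 / d\<close> producing the logarithm of the piece length.
\<close>

section \<open>Optimality of a minimizer along superlevel runs\<close>

lemma quantile_loss_shift_le: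
  assumes "0 < \<tau>" "\<tau> < 1" "0 \<le> \<eta>" "\<eta> \<le> t - c"
  shows "quantile_loss \<tau> (y - (t - \<eta>)) - quantile_loss \<tau> (y - t) \<le> \<eta> * (\<tau> - of_bool (y \<le> c))"
proof (cases "y \<le> c")
  case True
  then show ?thesis using assms by (auto simp: quantile_loss_def algebra_simps)
next
  case False
  have "\<eta> * (\<tau> - 1) \<le> \<eta> * \<tau>" "(y - t) * \<tau> \<le> (y - t) * (\<tau> - 1)" if "y < t"
    using assms that by (auto intro: mult_left_mono mult_left_mono_neg)
  moreover have "y - t + \<eta> \<le> 0 \<or> (y-t+\<eta>) \<ge> 0" by linarith
  ultimately show ?thesis using False assms by (auto simp: quantile_loss_def algebra_simps)
qed

text \<open>
  The whole deterministic argument rests on this optimality condition. Inside the window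
  \<open>{p..q}\<close> take the maximal run \<open>{a..b}\<close> around \<open>i\<close> on which \<open>\<theta> > c\<close> and lower \<open>\<theta>\<close> there by a
  small \<open>\<eta>\<close>. The objective cannot decrease. The loss changes by at most \<open>\<eta>\<close> times the negative of
  the sum on the left below. At an end of the run strictly inside the window the neighbour is at
  most \<open>c\<close>, so the jump shrinks by \<open>\<eta>\<close>; at an end shared with the window it grows by at most
  \<open>\<eta>\<close>; at the ends of the whole sequence there is no jump. Short runs are thus forbidden by the
  penalty and long ones by the drift of the noise.
\<close>

lemma superlevel_interval:
  assumes opt: "is_arg_min (fused_objective \<tau> lam n y) (\<lambda>_. True) \<theta>"
    and \<tau>: "0 < \<tau>" "\<tau> < 1" and "0 \<le> lam"
    and window: "1 \<le> p" "p \<le> i" "i \<le> q" "q \<le> n" and "c < \<theta> i"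
  obtains a b where "p \<le> a" "a \<le> i" "i \<le> b" "b \<le> q"
    "(\<Sum>j=a..b. of_bool (y j \<le> c) - \<tau>) \<le>
       lam * ((if a = 1 then 0 else if a = p then 1 else -1) + (if b = n then 0 else if b = q then 1 else -1))"
proof -
  define a where "a = (LEAST a. p \<le> a \<and> a \<le> i \<and> (\<forall>j\<in>{a..i}. c < \<theta> j))"
  define b where "b = (GREATEST b. i \<le> b \<and> b \<le> q \<and> (\<forall>j\<in>{i..b}. c < \<theta> j))"
  have a: "p \<le> a \<and> a \<le> i \<and> (\<forall>j\<in>{a..i}. c < \<theta> j)"
    unfolding a_def by (rule LeastI[of _ i]) (use window \<open>c < \<theta> i\<close> in auto)
  have b: "i \<le> b \<and> b \<le> q \<and> (\<forall>j\<in>{i..b}. c < \<theta> j)"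
    unfolding b_def by (rule GreatestI_nat[of _ i q]) (use window \<open>c < \<theta> i\<close> in auto)
  have left: "\<theta> (a - 1) \<le> c" if "a \<noteq> p"
  proof (rule ccontr)
    assume not_le: "\<not> ?thesis"
    have "c < \<theta> j" if "j \<in> {a - 1..i}" for j
      using not_le a that by (cases "j = a - 1") auto
    then have "p \<le> a - 1 \<and> a - 1 \<le> i \<and> (\<forall>j\<in>{a - 1..i}. c < \<theta> j)"
      using a that by auto
    then have "a \<le> a - 1" unfolding a_def by (rule Least_le)
    then show False using a that window by linarith
  qed
  have right: "\<theta> (b + 1) \<le> c" if "b \<noteq> q"
  proof (rule ccontr)
    assume "\<not> ?thesis"
    then have "i \<le> b + 1 \<and> b + 1 \<le> q \<and> (\<forall>j\<in>{i..b + 1}. c < \<theta> j)"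
      using b that by (auto simp: le_Suc_eq)
    then have "b + 1 \<le> b" unfolding b_def by (rule Greatest_le_nat[of _ _ q]) auto
    then show False by simp
  qed
  have ab: "1 \<le> a" "a \<le> b" "b \<le> n" using a b window by auto
  have above: "c < \<theta> j" if "j \<in> {a..b}" for j
    using a b that by (cases "j \<le> i") auto
  \<comment> \<open>With this step the lowered run does not fall below \<open>c\<close>, so the residual of an
    observation at most \<open>c\<close> keeps its sign and the jumps at inner ends shrink by the full step.\<close>
  define \<eta> where "\<eta> = Min ((\<lambda>j. \<theta> j - c) ` {a..b})"
  have \<eta>: "0 < \<eta>" "\<And>j. j \<in> {a..b} \<Longrightarrow> \<eta> \<le> \<theta> j - c"
    unfolding \<eta>_def using ab above by (auto simp: Min_gr_iff)
  define \<theta>' where "\<theta>' = (\<lambda>j. \<theta> j - \<eta> * of_bool (j \<in> {a..b}))"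
  define sL where "sL = (if a = 1 then 0 else if a = p then 1 else -1 :: real)"
  define sR where "sR = (if b = n then 0 else if b = q then 1 else -1 :: real)"
  have "(\<Sum>j=1..n. quantile_loss \<tau> (y j - \<theta>' j) - quantile_loss \<tau> (y j - \<theta> j))
        = (\<Sum>j=a..b. quantile_loss \<tau> (y j - \<theta>' j) - quantile_loss \<tau> (y j - \<theta> j))"
    using ab by (intro sum.mono_neutral_right) (auto simp: \<theta>'_def)
  also have "\<dots> \<le> (\<Sum>j=a..b. \<eta> * (\<tau> - of_bool (y j \<le> c)))"
    using quantile_loss_shift_le[OF \<tau>] \<eta> by (intro sum_mono) (auto simp: \<theta>'_def)
  finally have loss: "(\<Sum>j=1..n. quantile_loss \<tau> (y j - \<theta>' j)) - (\<Sum>j=1..n. quantile_loss \<tau> (y j - \<theta> j))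
      \<le> - \<eta> * (\<Sum>j=a..b. of_bool (y j \<le> c) - \<tau>)"
    by (simp add: sum_subtractf sum_distrib_left algebra_simps)
  have edge: "\<bar>\<theta>' e - \<theta>' (e + 1)\<bar> - \<bar>\<theta> e - \<theta> (e + 1)\<bar>
      \<le> (if e = a - 1 then \<eta> * sL else 0) + (if e = b then \<eta> * sR else 0)" if e: "e \<in> {1..n-1}" for e
  proof -
    consider "e = a - 1" "2 \<le> a" | "e = b" | "e + 1 < a \<or> b < e" | "a \<le> e" "e + 1 \<le> b"
      using e ab by force
    then show ?thesis
    proof cases
      case 1
      then have "\<theta>' e = \<theta> e" "\<theta>' (e + 1) = \<theta> a - \<eta>" "e + 1 = a" "e \<noteq> b" "\<eta> \<le> \<theta> a - c"
        using ab \<eta>(2)[of a] by (auto simp: \<theta>'_def)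
      then show ?thesis using 1 left \<eta> by (auto simp: sL_def)
    next
      case 2
      then have "\<theta>' e = \<theta> b - \<eta>" "\<theta>' (e + 1) = \<theta> (b + 1)" "e \<noteq> a - 1" "b \<noteq> n" "\<eta> \<le> \<theta> b - c"
        using e ab \<eta>(2)[of b] by (auto simp: \<theta>'_def)
      then show ?thesis using 2 right \<eta> by (auto simp: sR_def)
    next
      case 3
      then show ?thesis using ab e by (auto simp: \<theta>'_def)
    next
      case 4
      then show ?thesis using ab e by (auto simp: \<theta>'_def)
    qed
  qed
  have "(\<Sum>e=1..n-1. \<bar>\<theta>' e - \<theta>' (e + 1)\<bar>) - (\<Sum>e=1..n-1. \<bar>\<theta> e - \<theta> (e + 1)\<bar>)
      \<le> (\<Sum>e=1..n-1. (if e = a - 1 then \<eta> * sL else 0) + (if e = b then \<eta> * sR else 0))"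
    unfolding sum_subtractf[symmetric] by (rule sum_mono[OF edge])
  also have "\<dots> = \<eta> * (sL + sR)"
    using ab by (auto simp: sum.distrib sum.delta sL_def sR_def algebra_simps)
  finally have "lam * ((\<Sum>e=1..n-1. \<bar>\<theta>' e - \<theta>' (e + 1)\<bar>) - (\<Sum>e=1..n-1. \<bar>\<theta> e - \<theta> (e + 1)\<bar>))
      \<le> lam * (\<eta> * (sL + sR))"
    using \<open>0 \<le> lam\<close> by (rule mult_left_mono)
  moreover have "fused_objective \<tau> lam n y \<theta> \<le> fused_objective \<tau> lam n y \<theta>'"
    using opt by (auto simp: is_arg_min_linorder)
  ultimately have "0 \<le> \<eta> * (lam * (sL + sR) - (\<Sum>j=a..b. of_bool (y j \<le> c) - \<tau>))"
    using loss unfolding fused_objective_def by (simp add: algebra_simps)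
  then have "(\<Sum>j=a..b. of_bool (y j \<le> c) - \<tau>) \<le> lam * (sL + sR)"
    using \<eta> by (simp add: zero_le_mult_iff)
  then show ?thesis using that a b unfolding sL_def sR_def by blast
qed

text \<open>
  Reflection exchanges \<open>\<tau>\<close> with \<open>1 - \<tau>\<close> and turns every upper bound on a minimizer into a lower
  bound.
\<close>

lemma fused_minimizer_uminus:
  assumes "is_arg_min (fused_objective \<tau> lam n y) (\<lambda>_. True) \<theta>"
  shows "is_arg_min (fused_objective (1 - \<tau>) lam n (\<lambda>j. - y j)) (\<lambda>_. True) (\<lambda>j. - \<theta> j)"
proof -
  have ql: "quantile_loss (1 - \<tau>) (- x) = quantile_loss \<tau> x" for x
    by (auto simp: quantile_loss_def)
  have eq: "fused_objective (1 - \<tau>) lam n (\<lambda>j. - y j) \<phi> = fused_objective \<tau> lam n y (\<lambda>j. - \<phi> j)" for \<phi>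
  proof -
    have "quantile_loss (1 - \<tau>) (- y j - \<phi> j) = quantile_loss \<tau> (y j + \<phi> j)" for j
      using ql[of "y j + \<phi> j"] by simp
    moreover have "\<bar>\<phi> j - \<phi> (j + 1)\<bar> = \<bar>\<phi> (j + 1) - \<phi> j\<bar>" for j by simp
    ultimately show ?thesis by (simp add: fused_objective_def)
  qed
  show ?thesis using assms unfolding is_arg_min_linorder eq by simp
qed

text \<open>
  Here \<open>N\<close> is the length of a run, \<open>g\<close> the drift per observation, \<open>sqrt (N * r)\<close> the size of the
  fluctuations and \<open>s\<close> the penalty gained. By the inequality of arithmetic and geometric means, drift and
  penalty together beat the fluctuations at every length once \<open>g\<close> is of order \<open>r / s\<close>.
\<close>

lemma sqrt_le_drift:
  fixes g N r s :: real
  assumes "0 < s" "0 \<le> N" "0 \<le> r" "r / (4 * s) \<le> g"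
  shows "sqrt (N * r) \<le> N * g + s"
proof -
  have "0 \<le> g" using assms by (smt (verit) divide_nonneg_pos)
  have "r \<le> 4 * s * g" using assms by (simp add: field_simps)
  then have "N * r \<le> N * (4 * s * g)" using assms by (intro mult_left_mono) auto
  also have "\<dots> \<le> (N * g + s)\<^sup>2"
    using sum_squares_bound[of "N * g" s] by (simp add: power2_sum algebra_simps power2_eq_square)
  finally show ?thesis using assms \<open>0 \<le> g\<close> by (intro real_le_lsqrt) auto
qed

text \<open>
  The fluctuation per observation decreases with the length, so a run of length at least \<open>d\<close> needs
  no help from the penalty, and can even pay a penalty \<open>s\<close>.
\<close>

lemma sqrt_le_drift_long:
  fixes g N d r s :: real
  assumes "0 < d" "d \<le> N" "0 \<le> r" "s / N + sqrt (r / d) \<le> g"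
  shows "sqrt (N * r) + s \<le> N * g"
proof -
  have "sqrt (N * r) = N * sqrt (r / N)"
    using assms by (simp add: real_sqrt_mult real_sqrt_divide real_div_sqrt field_simps)
  also have "sqrt (r / N) \<le> sqrt (r / d)"
    using assms by (auto intro: divide_left_mono)
  finally have "sqrt (N * r) \<le> N * sqrt (r / d)" using assms by (simp add: mult_left_mono)
  moreover have "N * (s / N + sqrt (r / d)) \<le> N * g"
    using assms by (intro mult_left_mono) auto
  ultimately show ?thesis using assms by (simp add: algebra_simps)
qed

text \<open>
  The three summands in the lower bound for \<open>g\<close> answer the three ways in which a run can sit in the
  window. If both ends are interior, the penalty helps. If one end is shared, the penalties cancel,
  but the run reaches from \<open>i\<close> to an end of the window and is therefore long. If the run is the whole
  window, it has to pay twice the penalty, spread over the length of the window.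
\<close>

lemma minimizer_le_local:
  assumes opt: "is_arg_min (fused_objective \<tau> lam n y) (\<lambda>_. True) \<theta>"
    and \<tau>: "0 < \<tau>" "\<tau> < 1" and lam: "0 < lam" and r: "0 \<le> r"
    and window: "1 \<le> p" "p \<le> i" "i \<le> q" "q \<le> n"
    and drift: "\<And>a b. p \<le> a \<Longrightarrow> a \<le> b \<Longrightarrow> b \<le> q \<Longrightarrow>
      (\<Sum>j=a..b. of_bool (y j \<le> c) - \<tau>) > real (b + 1 - a) * g - sqrt (real (b + 1 - a) * r)"
    and g: "r / (4 * lam) + sqrt (r / real (min (i + 1 - p) (q + 1 - i))) + 2 * lam / real (q + 1 - p) \<le> g"
  shows "\<theta> i \<le> c"
proof (rule ccontr)
  assume "\<not> \<theta> i \<le> c"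
  then obtain a b where ab: "p \<le> a" "a \<le> i" "i \<le> b" "b \<le> q"
    "(\<Sum>j=a..b. of_bool (y j \<le> c) - \<tau>) \<le>
       lam * ((if a = 1 then 0 else if a = p then 1 else -1) + (if b = n then 0 else if b = q then 1 else -1))"
    using superlevel_interval[OF opt \<tau> less_imp_le[OF lam] window] by (metis not_le)
  define N where "N = real (b + 1 - a)"
  define d where "d = real (min (i + 1 - p) (q + 1 - i))"
  define m where "m = real (q + 1 - p)"
  have g': "r / (4 * lam) + sqrt (r / d) + 2 * lam / m \<le> g" using g by (simp add: d_def m_def)
  have "0 < d" "d \<le> m" "1 \<le> N" using ab by (auto simp: d_def m_def N_def)
  have nn: "0 \<le> r / (4 * lam)" "0 \<le> sqrt (r / d)" "0 \<le> 2 * lam / m"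
    using r lam \<open>0 < d\<close> by (auto simp: m_def)
  have gA: "r / (4 * lam) \<le> g" using g' nn by linarith
  have S: "lam * ((if a = p then 1 else -1) + (if b = q then 1 else -1)) > N * g - sqrt (N * r)"
  proof -
    have "N * g - sqrt (N * r) < (\<Sum>j=a..b. of_bool (y j \<le> c) - \<tau>)"
      unfolding N_def using ab window by (intro drift) auto
    also have "\<dots> \<le> lam * ((if a = 1 then 0 else if a = p then 1 else -1) + (if b = n then 0 else if b = q then 1 else -1))"
      by (fact ab)
    also have "\<dots> \<le> lam * ((if a = p then 1 else -1) + (if b = q then 1 else -1))"
      using lam window ab by (intro mult_left_mono add_mono) auto
    finally show ?thesis .
  qed
  consider "a = p" "b = q" | "a \<noteq> p" "b \<noteq> q" | "a = p \<and> b \<noteq> q \<or> a \<noteq> p \<and> b = q" by blast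
  then show False
  proof cases
    case 1
    have "sqrt (N * r) + 2 * lam \<le> N * g"
      using g' nn 1 \<open>d \<le> m\<close> by (intro sqrt_le_drift_long[of d] \<open>0 < d\<close> r) (auto simp: N_def m_def)
    then show False using S 1 by simp
  next
    case 2
    have "sqrt (N * r) \<le> N * g + lam"
      using gA \<open>1 \<le> N\<close> by (intro sqrt_le_drift lam r) auto
    then show False using S 2 lam by simp
  next
    case 3
    have "d \<le> N" using 3 ab by (auto simp: N_def d_def)
    then have "sqrt (N * r) + 0 \<le> N * g"
      using g' nn by (intro sqrt_le_drift_long[of d] \<open>0 < d\<close> r) auto
    then show False using S 3 by auto
  qed
qed

text \<open>
  With all observations as the window no run ever pays a penalty. This gives a bound that does not
  degrade near jumps, at the price of a level \<open>c\<close> that dominates the whole signal.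
\<close>

lemma minimizer_le_global:
  assumes opt: "is_arg_min (fused_objective \<tau> lam n y) (\<lambda>_. True) \<theta>"
    and \<tau>: "0 < \<tau>" "\<tau> < 1" and lam: "0 < lam" and r: "0 \<le> r" and i: "i \<in> {1..n}"
    and drift: "\<And>a b. 1 \<le> a \<Longrightarrow> a \<le> b \<Longrightarrow> b \<le> n \<Longrightarrow>
      (\<Sum>j=a..b. of_bool (y j \<le> c) - \<tau>) > real (b + 1 - a) * g - sqrt (real (b + 1 - a) * r)"
    and g: "r / (4 * lam) + sqrt (r / real n) \<le> g"
  shows "\<theta> i \<le> c"
proof (rule ccontr)
  have i': "1 \<le> i" "i \<le> n" using i by auto
  assume "\<not> \<theta> i \<le> c"
  then obtain a b where ab: "1 \<le> a" "a \<le> i" "i \<le> b" "b \<le> n"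
    "(\<Sum>j=a..b. of_bool (y j \<le> c) - \<tau>) \<le>
       lam * ((if a = 1 then 0 else if a = 1 then 1 else -1) + (if b = n then 0 else if b = n then 1 else -1))"
    using superlevel_interval[OF opt \<tau> less_imp_le[OF lam] order.refl i' order.refl] by (metis not_le)
  define N where "N = real (b + 1 - a)"
  have "1 \<le> N" using ab by (auto simp: N_def)
  have nn: "0 \<le> r / (4 * lam)" "0 \<le> sqrt (r / n)" using r lam by auto
  have gA: "r / (4 * lam) \<le> g" using g nn by linarith
  have S: "N * g - sqrt (N * r) < lam * ((if a = 1 then 0 else -1) + (if b = n then 0 else -1))"
    using drift[of a b] ab unfolding N_def by (auto split: if_splits)
  show False
  proof (cases "a = 1 \<and> b = n")
    case True
    have "sqrt (N * r) + 0 \<le> N * g"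
      using g nn True i' by (intro sqrt_le_drift_long[of n] r) (auto simp: N_def)
    then show False using S True by simp
  next
    case False
    have "sqrt (N * r) \<le> N * g + lam"
      using gA \<open>1 \<le> N\<close> by (intro sqrt_le_drift lam r) auto
    then show False using S False lam by (auto split: if_splits)
  qed
qed

lemma drift_uminus:
  fixes y :: "nat \<Rightarrow> real" and \<tau> w :: real
  assumes "(\<Sum>j=a..b. of_bool (y j \<le> c) - \<tau>) < - w"
  shows "(\<Sum>j=a..b. of_bool (- y j \<le> - c) - (1 - \<tau>)) > w"
proof -
  have "(\<Sum>j=a..b. - (of_bool (y j \<le> c) - \<tau>)) \<le> (\<Sum>j=a..b. of_bool (- y j \<le> - c) - (1 - \<tau>))"
    by (rule sum_mono) (simp add: of_bool_def)
  then have "- (\<Sum>j=a..b. of_bool (y j \<le> c) - \<tau>) \<le> (\<Sum>j=a..b. of_bool (- y j \<le> - c) - (1 - \<tau>))"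
    by (simp only: sum_negf [symmetric])
  then show ?thesis using assms by linarith
qed

lemma minimizer_ge_local:
  assumes opt: "is_arg_min (fused_objective \<tau> lam n y) (\<lambda>_. True) \<theta>"
    and \<tau>: "0 < \<tau>" "\<tau> < 1" and lam: "0 < lam" and r: "0 \<le> r"
    and window: "1 \<le> p" "p \<le> i" "i \<le> q" "q \<le> n"
    and drift: "\<And>a b. p \<le> a \<Longrightarrow> a \<le> b \<Longrightarrow> b \<le> q \<Longrightarrow>
      (\<Sum>j=a..b. of_bool (y j \<le> c) - \<tau>) < - (real (b + 1 - a) * g - sqrt (real (b + 1 - a) * r))"
    and g: "r / (4 * lam) + sqrt (r / real (min (i + 1 - p) (q + 1 - i))) + 2 * lam / real (q + 1 - p) \<le> g"
  shows "c \<le> \<theta> i"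
proof -
  have "- \<theta> i \<le> - c"
    by (rule minimizer_le_local[OF fused_minimizer_uminus[OF opt] _ _ lam r window drift_uminus[OF drift] g])
      (use \<tau> in auto)
  then show ?thesis by simp
qed

lemma minimizer_ge_global:
  assumes opt: "is_arg_min (fused_objective \<tau> lam n y) (\<lambda>_. True) \<theta>"
    and \<tau>: "0 < \<tau>" "\<tau> < 1" and lam: "0 < lam" and r: "0 \<le> r" and i: "i \<in> {1..n}"
    and drift: "\<And>a b. 1 \<le> a \<Longrightarrow> a \<le> b \<Longrightarrow> b \<le> n \<Longrightarrow>
      (\<Sum>j=a..b. of_bool (y j \<le> c) - \<tau>) < - (real (b + 1 - a) * g - sqrt (real (b + 1 - a) * r))"
    and g: "r / (4 * lam) + sqrt (r / real n) \<le> g"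
  shows "c \<le> \<theta> i"
proof -
  have "- \<theta> i \<le> - c"
    by (rule minimizer_le_global[OF fused_minimizer_uminus[OF opt] _ _ lam r i drift_uminus[OF drift] g])
      (use \<tau> in auto)
  then show ?thesis by simp
qed

section \<open>Uniform deviations of empirical distribution functions\<close>

context prob_space
begin

lemma indicator_sum_deviation:
  fixes \<epsilon> :: "nat \<Rightarrow> 'a \<Rightarrow> real"
  assumes indep: "indep_vars (\<lambda>_. borel) \<epsilon> J" and J: "finite J" "J \<noteq> {}"
    and cdf: "\<And>i. i \<in> J \<Longrightarrow> cdf (distr M borel (\<epsilon> i)) = F" and "0 \<le> r"
  shows "prob {\<omega>\<in>space M. \<bar>\<Sum>j\<in>J. of_bool (\<epsilon> j \<omega> \<le> x) - F x\<bar> \<ge> sqrt (real (card J) * r)} \<le> 2 * exp (- 2 * r)"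
proof -
  have rv: "\<epsilon> j \<in> borel_measurable M" if "j \<in> J" for j
    using indep that unfolding indep_vars_def by blast
  have exp: "expectation (\<lambda>\<omega>. of_bool (\<epsilon> j \<omega> \<le> x)) = F x" if "j \<in> J" for j
  proof -
    have [measurable]: "\<epsilon> j \<in> borel_measurable M" using rv that .
    have "expectation (\<lambda>\<omega>. of_bool (\<epsilon> j \<omega> \<le> x)) = expectation (indicator {\<omega>\<in>space M. \<epsilon> j \<omega> \<le> x})"
      by (intro Bochner_Integration.integral_cong) (auto simp: indicator_def)
    also have "\<dots> = prob {\<omega>\<in>space M. \<epsilon> j \<omega> \<le> x}" by (simp add: Int_def) (intro arg_cong[of _ _ prob]; blast)
    also have "\<dots> = cdf (distr M borel (\<epsilon> j)) x"
      unfolding cdf_def by (subst measure_distr) (auto intro!: arg_cong[of _ _ prob])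
    finally show ?thesis using cdf that by simp
  qed
  interpret Hoeffding_ineq M J "\<lambda>j \<omega>. of_bool (\<epsilon> j \<omega> \<le> x)" "\<lambda>_. 0" "\<lambda>_. 1"
    "\<Sum>j\<in>J. expectation (\<lambda>\<omega>. of_bool (\<epsilon> j \<omega> \<le> x))"
    using J indep_vars_compose2[OF indep, of "\<lambda>_ z. of_bool (z \<le> x)" "\<lambda>_. borel"]
    by unfold_locales auto
  have "prob {\<omega>\<in>space M. \<bar>(\<Sum>j\<in>J. of_bool (\<epsilon> j \<omega> \<le> x)) - (\<Sum>j\<in>J. expectation (\<lambda>\<omega>. of_bool (\<epsilon> j \<omega> \<le> x)))\<bar> \<ge> sqrt (real (card J) * r)}
      \<le> 2 * exp (- 2 * (sqrt (real (card J) * r))\<^sup>2 / (\<Sum>j\<in>J. (1 - 0)\<^sup>2))"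
    using J assms by (intro Hoeffding_ineq_abs_ge) (auto simp: card_gt_0_iff)
  then show ?thesis using J \<open>0 \<le> r\<close> exp by (simp add: sum_subtractf)
qed

text \<open>
  A union bound over all intervals and finitely many thresholds is affordable: for
  \<open>r = 3/2 * ln (n / \<delta>)\<close> Hoeffding's inequality gives each event probability
  \<open>2 * (\<delta> / n)^3\<close>, and with order \<open>n\<close> thresholds there are order \<open>n^3\<close> events. Uniformity
  thus costs only a constant factor in \<open>r\<close>.
\<close>

lemma uniform_interval_deviation:
  fixes \<epsilon> :: "nat \<Rightarrow> 'a \<Rightarrow> real"
  assumes indep: "indep_vars (\<lambda>_. borel) \<epsilon> {1..n}"
    and cdf: "\<And>i. i \<in> {1..n} \<Longrightarrow> cdf (distr M borel (\<epsilon> i)) = F" and "0 \<le> r" and X: "finite X"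
  shows "\<exists>A\<in>sets M. prob A \<ge> 1 - real (card X) * (real n)\<^sup>2 * (2 * exp (- 2 * r)) \<and>
    (\<forall>\<omega>\<in>A. \<forall>x\<in>X. \<forall>a b. 1 \<le> a \<longrightarrow> a \<le> b \<longrightarrow> b \<le> n \<longrightarrow>
       \<bar>\<Sum>j=a..b. of_bool (\<epsilon> j \<omega> \<le> x) - F x\<bar> < sqrt (real (b + 1 - a) * r))"
proof -
  define B where "B = (\<lambda>(x, a, b). {\<omega>\<in>space M. \<bar>\<Sum>j=a..b. of_bool (\<epsilon> j \<omega> \<le> x) - F x\<bar> \<ge> sqrt (real (b + 1 - a) * r)})"
  define T where "T = X \<times> {(a, b). a \<in> {1..n} \<and> b \<in> {a..n}}"
  have sub: "T \<subseteq> X \<times> {1..n} \<times> {1..n}" by (auto simp: T_def)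
  then have fin: "finite T" using X by (auto intro: finite_subset)
  have "card T \<le> card (X \<times> {1..n} \<times> {1..n})" using sub X by (intro card_mono) auto
  then have cardT: "real (card T) \<le> real (card X) * (real n)\<^sup>2"
    by (metis card_cartesian_product card_atLeastAtMost diff_Suc_1 of_nat_mono of_nat_mult power2_eq_square)
  have rv: "\<epsilon> j \<in> borel_measurable M" if "j \<in> {1..n}" for j
    using indep that unfolding indep_vars_def by blast
  have B: "B t \<in> sets M \<and> prob (B t) \<le> 2 * exp (- 2 * r)" if "t \<in> T" for t
  proof -
    obtain x a b where t': "t = (x, a, b)" by (cases t)
    then have t: "t = (x, a, b)" "x \<in> X" "1 \<le> a" "a \<le> b" "b \<le> n"
      using that by (auto simp: T_def)
    have [measurable]: "\<epsilon> j \<in> borel_measurable M" if "j \<in> {a..b}" for j using t that rv by auto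
    have [measurable]: "(\<lambda>\<omega>. \<Sum>j=a..b. of_bool (\<epsilon> j \<omega> \<le> x) - F x) \<in> borel_measurable M"
      by (intro borel_measurable_sum) (simp add: of_bool_def, measurable)
    have "B t \<in> sets M" unfolding B_def t prod.case by measurable
    moreover have "prob (B t) \<le> 2 * exp (- 2 * r)"
      using indicator_sum_deviation[of \<epsilon> "{a..b}" F r x] indep_vars_subset[OF indep] cdf t \<open>0 \<le> r\<close>
      by (auto simp: B_def)
    ultimately show ?thesis by simp
  qed
  have "prob (\<Union>t\<in>T. B t) \<le> (\<Sum>t\<in>T. prob (B t))"
    using B fin by (intro finite_measure_subadditive_finite) auto
  also have "\<dots> \<le> real (card T) * (2 * exp (- 2 * r))"
    using B by (intro sum_bounded_above) auto
  also have "\<dots> \<le> real (card X) * (real n)\<^sup>2 * (2 * exp (- 2 * r))"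
    using cardT by (intro mult_right_mono) auto
  finally have p: "prob (\<Union>t\<in>T. B t) \<le> real (card X) * (real n)\<^sup>2 * (2 * exp (- 2 * r))" .
  have U: "(\<Union>t\<in>T. B t) \<in> sets M" using B fin by auto
  show ?thesis
  proof (intro bexI conjI ballI allI impI)
    show "prob (space M - (\<Union>t\<in>T. B t)) \<ge> 1 - real (card X) * (real n)\<^sup>2 * (2 * exp (- 2 * r))"
      using prob_compl[OF U] p by linarith
    show "\<bar>\<Sum>j=a..b. of_bool (\<epsilon> j \<omega> \<le> x) - F x\<bar> < sqrt (real (b + 1 - a) * r)"
      if "\<omega> \<in> space M - (\<Union>t\<in>T. B t)" "x \<in> X" "1 \<le> a" "a \<le> b" "b \<le> n" for \<omega> x a b
    proof -
      have "(x, a, b) \<in> T" using that by (simp add: T_def)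
      then have "\<omega> \<notin> B (x, a, b)" using that(1) by blast
      then show ?thesis using that(1) by (simp add: B_def not_le)
    qed
  qed (use U in auto)
qed

end

section \<open>Pieces of a piecewise constant signal\<close>

text \<open>
  Summing the squared fluctuation \<open>r / d\<close> over a piece, \<open>d\<close> being the distance to the nearer end, is the
  source of the logarithmic factor \<open>ln m\<^sub>k\<close> in the error bound.
\<close>

lemma sum_inverse_end_distance_le:
  fixes p p' :: nat
  assumes "p < p'"
  shows "(\<Sum>i\<in>{p..<p'}. 1 / real (min (i + 1 - p) (p' - i))) \<le> 2 * (1 + ln (real (p' - p)))"
proof -
  define m where "m = p' - p"
  have m: "0 < m" using assms by (simp add: m_def)
  have min_le: "1 / real (min u v) \<le> inverse (real u) + inverse (real v)" for u v :: nat
    by (cases "u \<le> v") (auto simp: min_def inverse_eq_divide)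
  have "(\<Sum>i\<in>{p..<p'}. 1 / real (min (i + 1 - p) (p' - i)))
      \<le> (\<Sum>i\<in>{p..<p'}. inverse (real (i + 1 - p)) + inverse (real (p' - i)))"
    by (intro sum_mono min_le)
  also have "\<dots> = (\<Sum>i\<in>{p..<p'}. inverse (real (i + 1 - p))) + (\<Sum>i\<in>{p..<p'}. inverse (real (p' - i)))"
    by (rule sum.distrib)
  also have "(\<Sum>i\<in>{p..<p'}. inverse (real (i + 1 - p))) = harm m"
    unfolding harm_def m_def
    by (rule sum.reindex_bij_witness[of _ "\<lambda>k. k + p - 1" "\<lambda>i. i + 1 - p"]) auto
  also have "(\<Sum>i\<in>{p..<p'}. inverse (real (p' - i))) = harm m"
    unfolding harm_def m_def
    by (rule sum.reindex_bij_witness[of _ "\<lambda>k. p' - k" "\<lambda>i. p' - i"]) auto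
  also have "harm m \<le> 1 + ln (real m)"
    using euler_mascheroni_sequence_decreasing[of 1 m] m by (simp add: harm_def)
  finally show ?thesis by (simp add: m_def)
qed

lemma card_near_end_le:
  fixes p p' :: nat and D :: real
  assumes "0 \<le> D"
  shows "real (card {i \<in> {p..<p'}. real (min (i + 1 - p) (p' - i)) < D}) \<le> 2 * D"
proof -
  have *: "real (card {i \<in> {p..<p'}. real (f i) < D}) \<le> D"
    if f: "inj_on f {p..<p'}" "\<And>i. i \<in> {p..<p'} \<Longrightarrow> 1 \<le> f i" for f :: "nat \<Rightarrow> nat"
  proof -
    have "card {i \<in> {p..<p'}. real (f i) < D} \<le> card {1..nat \<lfloor>D\<rfloor>}"
    proof (rule card_inj_on_le[of f])
      show "inj_on f {i \<in> {p..<p'}. real (f i) < D}" by (rule inj_on_subset[OF f(1)]) auto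
      have "f i \<le> nat \<lfloor>D\<rfloor>" if "real (f i) < D" for i using that by (simp add: le_nat_floor)
      then show "f ` {i \<in> {p..<p'}. real (f i) < D} \<subseteq> {1..nat \<lfloor>D\<rfloor>}" using f(2) by auto
    qed simp
    also have "real (card {1..nat \<lfloor>D\<rfloor>}) \<le> D" using assms by (simp add: of_nat_floor)
    finally show ?thesis by simp
  qed
  have "{i \<in> {p..<p'}. real (min (i + 1 - p) (p' - i)) < D} \<subseteq>
      {i \<in> {p..<p'}. real (i + 1 - p) < D} \<union> {i \<in> {p..<p'}. real (p' - i) < D}" (is "?S \<subseteq> ?A \<union> ?B")
    by (auto simp: min_def)
  then have "card ?S \<le> card (?A \<union> ?B)" by (intro card_mono) auto
  also have "\<dots> \<le> card ?A + card ?B" by (rule card_Un_le)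
  finally have "card ?S \<le> card ?A + card ?B" .
  moreover have "real (card ?A) \<le> D" by (rule *) (auto simp: inj_on_def)
  moreover have "real (card ?B) \<le> D" by (rule *) (auto simp: inj_on_def)
  ultimately show ?thesis by linarith
qed

lemma piecewise_constant_piece:
  assumes "piecewise_constant n K \<nu> \<theta>" "k \<in> {1..K}"
  shows "1 \<le> \<nu> k" "\<nu> k < \<nu> (k + 1)" "\<nu> (k + 1) \<le> n + 1"
proof -
  have increasing: "\<nu> l < \<nu> (l + 1)" if "l \<in> {1..K}" for l
    using assms(1) that unfolding piecewise_constant_def by (cases "l = K") auto
  show "\<nu> k < \<nu> (k + 1)" using increasing assms(2) .
  have "\<nu> 1 \<le> \<nu> l" if "l \<in> {1..K}" for l
    using that
  proof (induction l)
    case (Suc l)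
    then show ?case using increasing[of l] by (cases "l = 0") auto
  qed simp
  then show "1 \<le> \<nu> k" using assms unfolding piecewise_constant_def by auto
  have "\<nu> (k + 1) \<le> \<nu> (K + 1)"
  proof -
    have "k + 1 \<le> K + 1" using assms(2) by simp
    then show ?thesis
    proof (induction rule: inc_induct)
      case (step l)
      have "l \<in> {1..K}" using step assms(2) by auto
      then show ?case using increasing[of l] step by simp
    qed simp
  qed
  then show "\<nu> (k + 1) \<le> n + 1" using assms(1) unfolding piecewise_constant_def by simp
qed

lemma sum_over_pieces:
  assumes "piecewise_constant n K \<nu> \<theta>"
  shows "(\<Sum>i=1..n. f i) = (\<Sum>k=1..K. \<Sum>i\<in>{\<nu> k..<\<nu> (k + 1)}. f i)"
proof -
  have "(\<Sum>i\<in>{1..<\<nu> (k + 1)}. f i) = (\<Sum>l=1..k. \<Sum>i\<in>{\<nu> l..<\<nu> (l + 1)}. f i)" if "k \<le> K" for k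
    using that
  proof (induction k)
    case 0
    then show ?case using assms unfolding piecewise_constant_def by simp
  next
    case (Suc k)
    then have "Suc k \<in> {1..K}" by simp
    note piecewise_constant_piece[OF assms this]
    then have "(\<Sum>i\<in>{1..<\<nu> (Suc k + 1)}. f i) =
      (\<Sum>i\<in>{1..<\<nu> (Suc k)}. f i) + (\<Sum>i\<in>{\<nu> (Suc k)..<\<nu> (Suc k + 1)}. f i)"
      by (intro sum.atLeastLessThan_concat[symmetric]) auto
    then show ?case using Suc by simp
  qed
  from this[of K] have "(\<Sum>i\<in>{1..<n + 1}. f i) = (\<Sum>k=1..K. \<Sum>i\<in>{\<nu> k..<\<nu> (k + 1)}. f i)"
    using assms unfolding piecewise_constant_def by simp
  moreover have "{1..<n + 1} = {1..n}" by auto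
  ultimately show ?thesis by (simp only:)
qed

section \<open>The error on a piece\<close>

lemma drift_above:
  fixes e y :: "nat \<Rightarrow> real"
  assumes "\<bar>\<Sum>j=a..b. of_bool (e j \<le> x) - Fx\<bar> < w" "g \<le> Fx - \<tau>"
    and "\<And>j. j \<in> {a..b} \<Longrightarrow> e j \<le> x \<Longrightarrow> y j \<le> c"
  shows "(\<Sum>j=a..b. of_bool (y j \<le> c) - \<tau>) > real (b + 1 - a) * g - w"
proof -
  have "real (b + 1 - a) * g \<le> real (b + 1 - a) * (Fx - \<tau>)" using assms by (intro mult_left_mono) auto
  moreover have "(\<Sum>j=a..b. of_bool (e j \<le> x) - \<tau>) = (\<Sum>j=a..b. of_bool (e j \<le> x) - Fx) + real (b + 1 - a) * (Fx - \<tau>)"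
    by (simp add: sum_subtractf algebra_simps)
  moreover have "(\<Sum>j=a..b. of_bool (e j \<le> x) - \<tau>) \<le> (\<Sum>j=a..b. of_bool (y j \<le> c) - \<tau>)"
    using assms by (intro sum_mono) auto
  ultimately show ?thesis using assms(1) by linarith
qed

lemma drift_below:
  fixes e y :: "nat \<Rightarrow> real"
  assumes "\<bar>\<Sum>j=a..b. of_bool (e j \<le> x) - Fx\<bar> < w" "g \<le> \<tau> - Fx"
    and "\<And>j. j \<in> {a..b} \<Longrightarrow> y j \<le> c \<Longrightarrow> e j \<le> x"
  shows "(\<Sum>j=a..b. of_bool (y j \<le> c) - \<tau>) < - (real (b + 1 - a) * g - w)"
proof -
  have "real (b + 1 - a) * g \<le> real (b + 1 - a) * (\<tau> - Fx)" using assms by (intro mult_left_mono) auto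
  moreover have "(\<Sum>j=a..b. of_bool (e j \<le> x) - \<tau>) = (\<Sum>j=a..b. of_bool (e j \<le> x) - Fx) - real (b + 1 - a) * (\<tau> - Fx)"
    by (simp add: sum_subtractf algebra_simps)
  moreover have "(\<Sum>j=a..b. of_bool (y j \<le> c) - \<tau>) \<le> (\<Sum>j=a..b. of_bool (e j \<le> x) - \<tau>)"
    using assms by (intro sum_mono) auto
  ultimately show ?thesis using assms(1) by linarith
qed

text \<open>
  These are the accuracies that \<open>minimizer_le_local\<close> and \<open>minimizer_le_global\<close> yield when a threshold
  \<open>x\<close> produces the drift \<open>L * x\<close>.
\<close>

definition local_radius :: "real \<Rightarrow> real \<Rightarrow> real \<Rightarrow> nat \<Rightarrow> nat \<Rightarrow> real" where
  "local_radius r lam L d m = (r / (4 * lam) + sqrt (r / real d) + 2 * lam / real m) / L"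

definition global_radius :: "real \<Rightarrow> real \<Rightarrow> real \<Rightarrow> nat \<Rightarrow> real" where
  "global_radius r lam L n = (r / (4 * lam) + sqrt (r / real n)) / L"

text \<open>
  The growth of \<open>F\<close> is known on \<open>[-1, 1]\<close> only, so the local radius is of use only if it is at most
  \<open>1\<close>. The smallness assumptions bound its penalty terms by \<open>1/8\<close> and \<open>1/6\<close>, and the middle term is at
  most \<open>1/2\<close> once \<open>d \<ge> 4 * r / L\<^sup>2\<close>. At the remaining points, which are close to an end of the piece,
  the global bound is used; it loses the oscillation \<open>V\<close> of the signal.
\<close>

lemma squared_error_le:
  fixes y \<theta>s e :: "nat \<Rightarrow> real"
  assumes opt: "is_arg_min (fused_objective \<tau> lam n y) (\<lambda>_. True) \<theta>"
    and \<tau>: "0 < \<tau>" "\<tau> < 1" and lam: "0 < lam" and L: "0 < L" and r: "0 \<le> r"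
    and noise: "\<And>j. j \<in> {1..n} \<Longrightarrow> y j = \<theta>s j + e j"
    and growth: "\<And>x. 0 \<le> x \<Longrightarrow> x \<le> 1 \<Longrightarrow> L * x \<le> F x - \<tau> \<and> L * x \<le> \<tau> - F (- x)"
    and window: "1 \<le> p" "p \<le> i" "i \<le> q" "q \<le> n"
    and const: "\<And>j. j \<in> {p..q} \<Longrightarrow> \<theta>s j = \<theta>s i"
    and osc: "\<And>j. j \<in> {1..n} \<Longrightarrow> \<bar>\<theta>s j - \<theta>s i\<bar> \<le> V"
    and d_def: "d = min (i + 1 - p) (q + 1 - i)" and m_def: "m = q + 1 - p"
    and small: "2 * r \<le> L * lam" "12 * lam \<le> L * real m" "12 * r \<le> L\<^sup>2 * real n"
    and dev: "\<And>x a b. x \<in> {local_radius r lam L d m, global_radius r lam L n} \<Longrightarrow> 1 \<le> a \<Longrightarrow> a \<le> b \<Longrightarrow> b \<le> n \<Longrightarrow>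
       \<bar>\<Sum>j=a..b. of_bool (e j \<le> x) - F x\<bar> < sqrt (real (b + 1 - a) * r) \<and>
       \<bar>\<Sum>j=a..b. of_bool (e j \<le> - x) - F (- x)\<bar> < sqrt (real (b + 1 - a) * r)"
  shows "(\<theta> i - \<theta>s i)\<^sup>2 \<le> 2 * V\<^sup>2 * of_bool (real d < 4 * r / L\<^sup>2)
      + 4 / L\<^sup>2 * ((r / (4 * lam))\<^sup>2 + r / real d + (2 * lam / real m)\<^sup>2)"
proof -
  define A C where "A = r / (4 * lam)" and "C = 2 * lam / real m"
  have d: "1 \<le> d" "d \<le> n" "1 \<le> m" and n: "1 \<le> n" using window by (auto simp: d_def m_def)
  have i: "i \<in> {1..n}" using window by auto
  have A: "0 \<le> A" "A \<le> L / 8" using r lam small by (auto simp: A_def field_simps)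
  have C: "0 \<le> C" "C \<le> L / 6" using lam small d by (auto simp: C_def field_simps)
  have half: "sqrt (r / real N) \<le> L / 2" if "4 * r / L\<^sup>2 \<le> real N" "1 \<le> N" for N :: nat
    using that L by (intro real_le_lsqrt) (auto simp: field_simps power2_eq_square)
  have sq3: "(a + b + c)\<^sup>2 \<le> 3 * (a\<^sup>2 + b\<^sup>2 + c\<^sup>2)" for a b c :: real
    using sum_squares_bound[of a b] sum_squares_bound[of b c] sum_squares_bound[of a c]
    by (simp add: power2_sum algebra_simps power2_eq_square)
  have sq2: "(a + b)\<^sup>2 \<le> 2 * a\<^sup>2 + 2 * b\<^sup>2" for a b :: real
    using sum_squares_bound[of a b] by (simp add: power2_sum)
  have sqrtsq: "(sqrt (r / real N))\<^sup>2 = r / real N" for N :: nat using r by simp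
  show ?thesis
  proof (cases "real d < 4 * r / L\<^sup>2")
    case False
    define x where "x = local_radius r lam L d m"
    have "0 \<le> sqrt (r / real d)" "sqrt (r / real d) \<le> L / 2" using r half[of d] False d by auto
    then have "0 \<le> A + sqrt (r / real d) + C" "A + sqrt (r / real d) + C \<le> L" using A C L by linarith+
    moreover have x_eq: "x = (A + sqrt (r / real d) + C) / L" by (simp add: x_def local_radius_def A_def C_def)
    ultimately have x: "0 \<le> x" "x \<le> 1" "L * x = A + sqrt (r / real d) + C" using L by auto
    have g: "L * x \<le> F x - \<tau>" "L * x \<le> \<tau> - F (- x)" using growth[OF x(1,2)] by blast+
    have dev': "\<bar>\<Sum>j=a..b. of_bool (e j \<le> x) - F x\<bar> < sqrt (real (b + 1 - a) * r)"
       "\<bar>\<Sum>j=a..b. of_bool (e j \<le> - x) - F (- x)\<bar> < sqrt (real (b + 1 - a) * r)"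
      if "1 \<le> a" "a \<le> b" "b \<le> n" for a b using dev[of x a b] that by (auto simp: x_def)
    have Lx: "r / (4 * lam) + sqrt (r / real (min (i + 1 - p) (q + 1 - i))) + 2 * lam / real (q + 1 - p) \<le> L * x"
      unfolding x(3) A_def C_def d_def m_def by simp
    have y: "y j = \<theta>s i + e j" if "j \<in> {p..q}" for j using noise[of j] const[of j] that window by auto
    have "\<theta> i \<le> \<theta>s i + x"
      using window y by (intro minimizer_le_local[OF opt \<tau> lam r window _ Lx] drift_above[OF dev'(1) g(1)]) auto
    moreover have "\<theta>s i - x \<le> \<theta> i"
      using window y by (intro minimizer_ge_local[OF opt \<tau> lam r window _ Lx] drift_below[OF dev'(2) g(2)]) auto
    ultimately have "\<bar>\<theta> i - \<theta>s i\<bar> \<le> x" by linarith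
    then have "(\<theta> i - \<theta>s i)\<^sup>2 \<le> x\<^sup>2" using x by (simp add: abs_le_square_iff[symmetric])
    also have "\<dots> = (A + sqrt (r / real d) + C)\<^sup>2 / L\<^sup>2"
      unfolding x_eq by (rule power_divide)
    also have "\<dots> \<le> 4 * (A\<^sup>2 + r / real d + C\<^sup>2) / L\<^sup>2"
    proof (rule divide_right_mono)
      have "(A + sqrt (r / real d) + C)\<^sup>2 \<le> 3 * (A\<^sup>2 + r / real d + C\<^sup>2)"
        using sq3[of A "sqrt (r / real d)" C] unfolding sqrtsq .
      also have "\<dots> \<le> 4 * (A\<^sup>2 + r / real d + C\<^sup>2)" using r by (intro mult_right_mono) auto
      finally show "(A + sqrt (r / real d) + C)\<^sup>2 \<le> 4 * (A\<^sup>2 + r / real d + C\<^sup>2)" .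
    qed simp
    finally show ?thesis using False by (simp add: A_def C_def)
  next
    case True
    define x where "x = global_radius r lam L n"
    have "4 * r / L\<^sup>2 \<le> real n" using small(3) L r by (simp add: field_simps)
    then have "0 \<le> sqrt (r / real n)" "sqrt (r / real n) \<le> L / 2" using r half[of n] n by auto
    then have "0 \<le> A + sqrt (r / real n)" "A + sqrt (r / real n) \<le> L" using A L by linarith+
    moreover have x_eq: "x = (A + sqrt (r / real n)) / L" by (simp add: x_def global_radius_def A_def)
    ultimately have x: "0 \<le> x" "x \<le> 1" "L * x = A + sqrt (r / real n)" using L by auto
    have g: "L * x \<le> F x - \<tau>" "L * x \<le> \<tau> - F (- x)" using growth[OF x(1,2)] by blast+
    have dev': "\<bar>\<Sum>j=a..b. of_bool (e j \<le> x) - F x\<bar> < sqrt (real (b + 1 - a) * r)"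
       "\<bar>\<Sum>j=a..b. of_bool (e j \<le> - x) - F (- x)\<bar> < sqrt (real (b + 1 - a) * r)"
      if "1 \<le> a" "a \<le> b" "b \<le> n" for a b using dev[of x a b] that by (auto simp: x_def)
    have Lx: "r / (4 * lam) + sqrt (r / real n) \<le> L * x" unfolding x(3) A_def by simp
    have y: "\<theta>s i - V + e j \<le> y j" "y j \<le> \<theta>s i + V + e j" if "j \<in> {1..n}" for j
      using noise[of j] osc[of j] that by auto
    have V: "0 \<le> V" using osc[OF i] by simp
    have "\<theta> i \<le> \<theta>s i + V + x"
    proof (rule minimizer_le_global[OF opt \<tau> lam r i _ Lx], rule drift_above[OF dev'(1) g(1)])
      fix a b j assume "1 \<le> a" "b \<le> n" "j \<in> {a..b}" "e j \<le> x"
      then show "y j \<le> \<theta>s i + V + x" using y(2)[of j] by auto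
    qed auto
    moreover have "\<theta>s i - V - x \<le> \<theta> i"
    proof (rule minimizer_ge_global[OF opt \<tau> lam r i _ Lx], rule drift_below[OF dev'(2) g(2)])
      fix a b j assume "1 \<le> a" "b \<le> n" "j \<in> {a..b}" "y j \<le> \<theta>s i - V - x"
      then show "e j \<le> - x" using y(1)[of j] by auto
    qed auto
    ultimately have "\<bar>\<theta> i - \<theta>s i\<bar> \<le> V + x" by linarith
    then have "(\<theta> i - \<theta>s i)\<^sup>2 \<le> (V + x)\<^sup>2" using x V by (simp add: abs_le_square_iff[symmetric])
    also have "\<dots> \<le> 2 * V\<^sup>2 + 2 * x\<^sup>2" by (rule sq2)
    also have "x\<^sup>2 = (A + sqrt (r / real n))\<^sup>2 / L\<^sup>2"
      unfolding x_eq by (rule power_divide)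
    also have "2 * ((A + sqrt (r / real n))\<^sup>2 / L\<^sup>2) \<le> 2 * ((2 * (A\<^sup>2 + r / real d + C\<^sup>2)) / L\<^sup>2)"
    proof (intro mult_left_mono divide_right_mono)
      have "(A + sqrt (r / real n))\<^sup>2 \<le> 2 * A\<^sup>2 + 2 * (r / real n)"
        using sq2[of A "sqrt (r / real n)"] unfolding sqrtsq .
      also have "\<dots> \<le> 2 * A\<^sup>2 + 2 * (r / real d)"
        using r d by (intro add_left_mono mult_left_mono divide_left_mono) auto
      also have "\<dots> \<le> 2 * (A\<^sup>2 + r / real d + C\<^sup>2)" by simp
      finally show "(A + sqrt (r / real n))\<^sup>2 \<le> 2 * (A\<^sup>2 + r / real d + C\<^sup>2)" .
    qed auto
    finally show ?thesis using True by (simp add: A_def C_def)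
  qed
qed

lemma piece_error_le:
  fixes p p' m :: nat and err :: "nat \<Rightarrow> real"
  assumes err: "\<And>i. i \<in> {p..<p'} \<Longrightarrow> err i \<le> 2 * V\<^sup>2 * of_bool (real (min (i + 1 - p) (p' - i)) < 4 * r / L\<^sup>2)
      + 4 / L\<^sup>2 * ((r / (4 * lam))\<^sup>2 + r / real (min (i + 1 - p) (p' - i)) + (2 * lam / real m)\<^sup>2)"
    and "0 < L" "0 < lam" "0 \<le> r" and m: "m = p' - p" "2 \<le> m"
  shows "(\<Sum>i\<in>{p..<p'}. err i) \<le> 16 * r / L\<^sup>2 * V\<^sup>2 + real m * (r\<^sup>2 / (4 * L\<^sup>2 * lam\<^sup>2))
      + 16 * r / L\<^sup>2 * (1 + ln (real m / 2)) + 16 * lam\<^sup>2 / L\<^sup>2 * (1 / real m)"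
proof -
  define d where "d = (\<lambda>i. min (i + 1 - p) (p' - i))"
  have pp: "p < p'" using m by simp
  have expand: "2 * v * (2 * (4 * r / l)) + 4 / l * (z * (r / (4 * t))\<^sup>2 + r * (2 * (2 * g)) + z * (2 * t / z)\<^sup>2)
      = 16 * r / l * v + z * (r\<^sup>2 / (4 * l * t\<^sup>2)) + 16 * r / l * g + 16 * t\<^sup>2 / l * (1 / z)"
    if "z \<noteq> 0" "l \<noteq> 0" "t \<noteq> 0" for v r l z t g :: real
    using that by (simp add: field_simps power2_eq_square)
  have m0: "real m \<noteq> 0" using m by simp
  have "(\<Sum>i\<in>{p..<p'}. err i) \<le> (\<Sum>i\<in>{p..<p'}. 2 * V\<^sup>2 * of_bool (real (d i) < 4 * r / L\<^sup>2)
      + 4 / L\<^sup>2 * ((r / (4 * lam))\<^sup>2 + r * (1 / real (d i)) + (2 * lam / real m)\<^sup>2))"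
    using err by (intro sum_mono) (auto simp: d_def)
  also have "\<dots> = 2 * V\<^sup>2 * (\<Sum>i\<in>{p..<p'}. of_bool (real (d i) < 4 * r / L\<^sup>2))
     + 4 / L\<^sup>2 * (real m * (r / (4 * lam))\<^sup>2 + r * (\<Sum>i\<in>{p..<p'}. 1 / real (d i)) + real m * (2 * lam / real m)\<^sup>2)"
    unfolding m by (simp only: sum.distrib sum_distrib_left[symmetric] sum_constant card_atLeastLessThan)
  also have "(\<Sum>i\<in>{p..<p'}. of_bool (real (d i) < 4 * r / L\<^sup>2)) = real (card {i \<in> {p..<p'}. real (d i) < 4 * r / L\<^sup>2})"
    by (simp add: Int_def)
  also have "2 * V\<^sup>2 * \<dots> \<le> 2 * V\<^sup>2 * (2 * (4 * r / L\<^sup>2))"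
    unfolding d_def using assms by (intro mult_left_mono card_near_end_le) auto
  also have "r * (\<Sum>i\<in>{p..<p'}. 1 / real (d i)) \<le> r * (2 * (1 + ln (real m)))"
    unfolding d_def m using assms pp by (intro mult_left_mono sum_inverse_end_distance_le) auto
  also have "1 + ln (real m) \<le> 2 * (1 + ln (real m / 2))"
  proof -
    have "1 + ln t \<le> 2 * (1 + ln (t / 2))" if "2 \<le> t" for t :: real
    proof -
      have "ln 2 \<le> ln t" "ln (t / 2) = ln t - ln 2" using that by (auto simp: ln_div)
      moreover have "ln 2 < (1 :: real)" by (rule ln_2_less_1)
      ultimately show ?thesis by argo
    qed
    then show ?thesis using m(2) by simp
  qed
  finally have "(\<Sum>i\<in>{p..<p'}. err i) \<le> 2 * V\<^sup>2 * (2 * (4 * r / L\<^sup>2)) + 4 / L\<^sup>2 *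
      (real m * (r / (4 * lam))\<^sup>2 + r * (2 * (2 * (1 + ln (real m / 2)))) + real m * (2 * lam / real m)\<^sup>2)"
    using assms by (simp add: mult_left_mono divide_right_mono)
  also have "\<dots> = 16 * r / L\<^sup>2 * V\<^sup>2 + real m * (r\<^sup>2 / (4 * L\<^sup>2 * lam\<^sup>2))
      + 16 * r / L\<^sup>2 * (1 + ln (real m / 2)) + 16 * lam\<^sup>2 / L\<^sup>2 * (1 / real m)"
    by (rule expand) (use m0 assms in auto)
  finally show ?thesis .
qed

section \<open>The risk bound\<close>

theorem corollary3:
  fixes M :: "'a measure" and \<epsilon> :: "nat \<Rightarrow> 'a \<Rightarrow> real" and F :: "real \<Rightarrow> real"
    and y :: "nat \<Rightarrow> 'a \<Rightarrow> real" and \<theta>s :: "nat \<Rightarrow> real" and \<theta>h :: "'a \<Rightarrow> nat \<Rightarrow> real"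
    and \<nu> m :: "nat \<Rightarrow> nat" and n K :: nat and \<tau> L lam \<delta> m_min V :: real
  assumes "prob_space M"
    and "0 < \<tau>" and "\<tau> < 1"
    and "piecewise_constant n K \<nu> \<theta>s"
    and "\<And>k. m k = piece_length \<nu> k"
    and "\<And>i \<omega>. i \<in> {1..n} \<Longrightarrow> \<omega> \<in> space M \<Longrightarrow> y i \<omega> = \<theta>s i + \<epsilon> i \<omega>"
    and "prob_space.indep_vars M (\<lambda>_. borel) \<epsilon> {1..n}"
    and "\<And>i. i \<in> {1..n} \<Longrightarrow> cdf (distr M borel (\<epsilon> i)) = F"
    and "F 0 = \<tau>"
    and "L > 0" and "\<And>x. x \<in> {-1..1} \<Longrightarrow> \<bar>F x - F 0\<bar> \<ge> L * \<bar>x\<bar>"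
    and "\<And>\<omega>. \<omega> \<in> space M \<Longrightarrow>
           is_arg_min (fused_objective \<tau> lam n (\<lambda>i. y i \<omega>)) (\<lambda>_. True) (\<theta>h \<omega>)"
    and "m_min = real (Min (m ` {1..K}))"
    and "V = Max (\<theta>s ` {1..n}) - Min (\<theta>s ` {1..n})"
    and "0 < \<delta>" and "\<delta> < (ln 2 / exp 1)\<^sup>2"
    and "m_min \<ge> 18 / L\<^sup>2 * ln (real n / \<delta>)"
    and "3 * (2 * ln (ln (2 * real n)) + ln (real n / \<delta>)) / L \<le> lam" and "lam \<le> L / 12 * m_min"
  shows "\<exists>A \<in> sets M. measure M A \<ge> 1 - 4 * (1 + 24 / (ln 2)\<^sup>2) * \<delta> \<and>
    (\<forall>\<omega>\<in>A. (\<Sum>i = 1..n. \<bar>\<theta>h \<omega> i - \<theta>s i\<bar>\<^sup>2) \<le>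
        24 / L\<^sup>2 * (2 * ln (ln (2 * real n)) + ln (real n / \<delta>)) * (real K + (\<Sum>k = 1..K. ln (real (m k) / 2)))
      + 3 * real n / L\<^sup>2 * (4 * ((ln (ln (2 * real n)))\<^sup>2 + (ln (real n / \<delta>))\<^sup>2) / lam\<^sup>2)
      + 6 * real K / L\<^sup>2 * ln (real n / \<delta>)
      + 24 * lam\<^sup>2 / L\<^sup>2 * (\<Sum>k = 1..K. 1 / real (m k))
      + 2 * real K * Max {3, 12 ^ 4 / L ^ 4, 12\<^sup>2 / (2 * L\<^sup>2) * ln (real n / \<delta>)} * V\<^sup>2)"
proof -
  interpret prob_space M by fact
  note pc = assms(4) and noise = assms(6) and indep = assms(7) and cdf = assms(8) and F0 = assms(9)
    and L = assms(10) and growth0 = assms(11) and opt = assms(12) and V_def = assms(14)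
  define u where "u = ln (real n / \<delta>)"
  define w where "w = ln (ln (2 * real n))"
  \<comment> \<open>Chosen such that \<open>exp (- 2 * r) = (\<delta> / n)^3\<close>, which pays for order \<open>n^3\<close> events.\<close>
  define r where "r = 3 / 2 * u"
  have K: "1 \<le> K" and n: "2 \<le> n" using pc piecewise_constant_piece[OF pc, of K]
    unfolding piecewise_constant_def by auto
  have "ln 2 < (1::real)" "1 < exp (1::real)" by (auto simp: ln_2_less_1)
  then have "ln 2 / exp 1 < (1::real)" by (simp only: divide_less_eq_1_pos exp_gt_zero)
  then have "(ln 2 / exp 1)\<^sup>2 \<le> (1::real)" by (intro power_le_one) auto
  then have \<delta>: "0 < \<delta>" "\<delta> < 1" using assms by auto
  have "2 * \<delta> \<le> real n" using n \<delta> by (simp add: order_trans[of _ 2])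
  then have "ln 2 \<le> u" unfolding u_def using \<delta> by (simp add: field_simps)
  then have u: "2 / 3 \<le> u" using ln2_ge_two_thirds by simp
  have "exp 1 \<le> (4::real)" using exp_le by simp
  then have "exp 1 \<le> 2 * real n" using n by simp
  then have "1 \<le> ln (2 * real n)" using n by (simp add: ln_ge_iff)
  then have w: "0 \<le> w" unfolding w_def by simp
  have r: "0 \<le> r" using u by (simp add: r_def)
  have piece: "1 \<le> \<nu> k" "\<nu> k < \<nu> (k + 1)" "\<nu> (k + 1) \<le> n + 1" "m k = \<nu> (k + 1) - \<nu> k"
    if "k \<in> {1..K}" for k
    using piecewise_constant_piece[OF pc that] assms(5) by (auto simp: piece_length_def)
  have sum_m: "(\<Sum>k=1..K. real (m k)) = real n"
    using sum_over_pieces[OF pc, of "\<lambda>_. 1 :: real"] piece(4) by simp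
  have "L * 1 \<le> \<bar>F 1 - F 0\<bar>" using growth0[of 1] by simp
  define \<mu> where "\<mu> = distr M borel (\<epsilon> 1)"
  have rv: "\<epsilon> 1 \<in> borel_measurable M" using indep n unfolding indep_vars_def by auto
  interpret \<mu>: real_distribution \<mu> unfolding \<mu>_def using rv by (rule real_distribution_distr)
  have F: "F = cdf \<mu>" unfolding \<mu>_def using cdf[of 1] n by auto
  have F_mono: "F x \<le> F z" if "x \<le> z" for x z unfolding F using that by (rule \<mu>.cdf_nondecreasing)
  have F_range: "0 \<le> F x" "F x \<le> 1" for x unfolding F by (rule \<mu>.cdf_nonneg, rule \<mu>.cdf_bounded_prob)
  have L1: "L \<le> 1" using growth0[of 1] F_range[of 0] F_range[of 1] by auto
  have growth: "L * x \<le> F x - \<tau> \<and> L * x \<le> \<tau> - F (- x)" if "0 \<le> x" "x \<le> 1" for x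
    using growth0[of x] growth0[of "-x"] F_mono[of 0 x] F_mono[of "-x" 0] F0 that by auto
  have m_min: "m_min \<le> real (m k)" if "k \<in> {1..K}" for k
    using that assms(13) by simp
  have m_min_u: "18 * u \<le> L\<^sup>2 * m_min" using assms(17) L by (simp add: u_def field_simps)
  have m2: "2 \<le> m k" if "k \<in> {1..K}" for k
  proof -
    have "L\<^sup>2 \<le> 1" using L L1 by (intro power_le_one) auto
    then have "L\<^sup>2 * real (m k) \<le> real (m k)" by (simp add: mult_left_le_one_le)
    moreover have "L\<^sup>2 * m_min \<le> L\<^sup>2 * real (m k)" using m_min[OF that] by (intro mult_left_mono) auto
    ultimately show ?thesis using m_min_u u by linarith
  qed
  have "3 * (2 * w + u) \<le> lam * L" using assms(18) L by (simp add: u_def w_def field_simps)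
  then have lamu: "3 * u \<le> L * lam" using w by (simp add: algebra_simps)
  then have "0 < L * lam" using u by linarith
  then have lam: "0 < lam" using L by (simp add: zero_less_mult_iff)
  have lam_m: "12 * lam \<le> L * real (m k)" if "k \<in> {1..K}" for k
  proof -
    have "L * m_min \<le> L * real (m k)" using m_min[OF that] L by (intro mult_left_mono) auto
    then show ?thesis using assms(19) by simp
  qed
  have r_n: "12 * r \<le> L\<^sup>2 * real n"
  proof -
    have "real (m 1) \<le> real n" using piece[of 1] K by auto
    then have "m_min \<le> real n" using m_min[of 1] K by auto
    then have "L\<^sup>2 * m_min \<le> L\<^sup>2 * real n" by (intro mult_left_mono) auto
    then show ?thesis using m_min_u by (simp add: r_def)
  qed
  define d where "d = (\<lambda>k i. min (i + 1 - \<nu> k) (\<nu> (k + 1) - i))"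
  define P where "P = (SIGMA k:{1..K}. {\<nu> k..<\<nu> (k + 1)})"
  \<comment> \<open>One threshold for each observation, the global one, and their negatives: order \<open>n\<close> in all.\<close>
  define Y where "Y = insert (global_radius r lam L n) ((\<lambda>(k, i). local_radius r lam L (d k i) (m k)) ` P)"
  define X where "X = Y \<union> uminus ` Y"
  have "finite P" by (auto simp: P_def)
  have "card P = n"
  proof -
    have "real (card P) = real n" using sum_m piece(4) by (simp add: P_def)
    then show ?thesis by simp
  qed
  have finY: "finite Y" using \<open>finite P\<close> by (simp add: Y_def)
  have "card Y \<le> Suc n" unfolding Y_def
    using card_image_le[OF \<open>finite P\<close>, of "\<lambda>(k, i). local_radius r lam L (d k i) (m k)"] \<open>card P = n\<close>
    by (intro order_trans[OF card_insert_le_m1]) auto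
  then have "card X \<le> 2 * (n + 1)"
    using card_Un_le[of Y "uminus ` Y"] card_image_le[OF finY, of uminus] by (simp add: X_def)
  then have "card X \<le> 4 * n" using n by simp
  then have cardX: "real (card X) \<le> 4 * real n" by (metis of_nat_le_iff of_nat_mult of_nat_numeral)
  have finX: "finite X" using finY by (simp add: X_def)
  obtain A where A: "A \<in> sets M" "prob A \<ge> 1 - real (card X) * (real n)\<^sup>2 * (2 * exp (- 2 * r))"
    and dev: "\<forall>\<omega>\<in>A. \<forall>x\<in>X. \<forall>a b. 1 \<le> a \<longrightarrow> a \<le> b \<longrightarrow> b \<le> n \<longrightarrow>
       \<bar>\<Sum>j=a..b. of_bool (\<epsilon> j \<omega> \<le> x) - F x\<bar> < sqrt (real (b + 1 - a) * r)"
    using uniform_interval_deviation[OF indep cdf r finX] by blast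
  have A_space: "A \<subseteq> space M" using A(1) by (rule sets.sets_into_space)
  \<comment> \<open>The failure probability \<open>8 * \<delta>^3\<close> is well below the one allowed.\<close>
  have prob_A: "measure M A \<ge> 1 - 4 * (1 + 24 / (ln 2)\<^sup>2) * \<delta>"
  proof -
    have "exp (- 2 * r) = exp (- u) ^ 3"
      by (simp add: r_def exp_of_nat_mult[symmetric])
    also have "exp (- u) = \<delta> / real n"
      using \<delta> n by (simp add: u_def exp_minus)
    finally have "real (card X) * (real n)\<^sup>2 * (2 * exp (- 2 * r)) \<le> 4 * real n * (real n)\<^sup>2 * (2 * (\<delta> / real n) ^ 3)"
      using cardX \<delta> by (simp only:) (intro mult_mono mult_nonneg_nonneg, auto)
    also have "\<dots> = 8 * \<delta> ^ 3"
      using n by (simp add: field_simps power2_eq_square power3_eq_cube)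
    also have "\<dots> \<le> 8 * \<delta>"
      using \<delta> power_decreasing[of 1 3 \<delta>] by simp
    also have "\<dots> \<le> 4 * (1 + 24 / (ln 2)\<^sup>2) * \<delta>"
    proof -
      have "(ln 2)\<^sup>2 \<le> (1::real)" using ln_2_less_1 by (intro power_le_one) auto
      then have "1 \<le> 24 / (ln 2 :: real)\<^sup>2" by (simp add: field_simps)
      then have "4 * (1 + 1) * \<delta> \<le> 4 * (1 + 24 / (ln 2)\<^sup>2) * \<delta>"
        using \<delta> by (intro mult_right_mono mult_left_mono add_left_mono) simp_all
      then show ?thesis by simp
    qed
    finally show ?thesis using A(2) by linarith
  qed
  have err_bound: "(\<Sum>i = 1..n. \<bar>\<theta>h \<omega> i - \<theta>s i\<bar>\<^sup>2) \<le>
        24 / L\<^sup>2 * (2 * w + u) * (real K + (\<Sum>k = 1..K. ln (real (m k) / 2)))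
      + 3 * real n / L\<^sup>2 * (4 * (w\<^sup>2 + u\<^sup>2) / lam\<^sup>2)
      + 6 * real K / L\<^sup>2 * u
      + 24 * lam\<^sup>2 / L\<^sup>2 * (\<Sum>k = 1..K. 1 / real (m k))
      + 2 * real K * Max {3, 12 ^ 4 / L ^ 4, 12\<^sup>2 / (2 * L\<^sup>2) * u} * V\<^sup>2" (is "_ \<le> ?T1 + ?T2 + ?T3 + ?T4 + ?T5")
    if \<omega>: "\<omega> \<in> A" for \<omega>
  proof -
    have \<omega>': "\<omega> \<in> space M" using \<omega> A_space by blast
    have osc: "\<bar>\<theta>s j - \<theta>s i\<bar> \<le> V" if "i \<in> {1..n}" "j \<in> {1..n}" for i j
    proof -
      have "\<theta>s l \<le> Max (\<theta>s ` {1..n})" "Min (\<theta>s ` {1..n}) \<le> \<theta>s l" if "l \<in> {1..n}" for l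
        using that by auto
      from this[OF \<open>i \<in> {1..n}\<close>] this[OF \<open>j \<in> {1..n}\<close>] show ?thesis unfolding V_def by linarith
    qed
    have pointwise: "(\<theta>h \<omega> i - \<theta>s i)\<^sup>2 \<le> 2 * V\<^sup>2 * of_bool (real (d k i) < 4 * r / L\<^sup>2)
        + 4 / L\<^sup>2 * ((r / (4 * lam))\<^sup>2 + r / real (d k i) + (2 * lam / real (m k))\<^sup>2)"
      if k: "k \<in> {1..K}" and i: "i \<in> {\<nu> k..<\<nu> (k + 1)}" for k i
    proof (rule squared_error_le[where p = "\<nu> k" and q = "\<nu> (k + 1) - 1" and e = "\<lambda>j. \<epsilon> j \<omega>" and F = F
          and n = n and y = "\<lambda>j. y j \<omega>" and \<tau> = \<tau>])
      show "is_arg_min (fused_objective \<tau> lam n (\<lambda>j. y j \<omega>)) (\<lambda>_. True) (\<theta>h \<omega>)" using opt[OF \<omega>'] .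
      show "y j \<omega> = \<theta>s j + \<epsilon> j \<omega>" if "j \<in> {1..n}" for j using noise[OF that \<omega>'] .
      show "\<theta>s j = \<theta>s i" if "j \<in> {\<nu> k..\<nu> (k + 1) - 1}" for j
      proof -
        have "j \<in> {\<nu> k..<\<nu> (k + 1)}" using that piece[OF k] by auto
        then have "\<theta>s j = \<theta>s (\<nu> k)" "\<theta>s i = \<theta>s (\<nu> k)"
          using pc k i unfolding piecewise_constant_def by blast+
        then show ?thesis by simp
      qed
      show "\<bar>\<theta>s j - \<theta>s i\<bar> \<le> V" if "j \<in> {1..n}" for j using osc[of i j] that i piece[OF k] by auto
      show "2 * r \<le> L * lam" using lamu by (simp add: r_def)
      have inX: "x \<in> X" "- x \<in> X" if "x \<in> {local_radius r lam L (d k i) (m k), global_radius r lam L n}" for x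
        using that k i unfolding X_def Y_def P_def by force+
      show "\<bar>\<Sum>j=a..b. of_bool (\<epsilon> j \<omega> \<le> x) - F x\<bar> < sqrt (real (b + 1 - a) * r) \<and>
       \<bar>\<Sum>j=a..b. of_bool (\<epsilon> j \<omega> \<le> - x) - F (- x)\<bar> < sqrt (real (b + 1 - a) * r)"
        if "x \<in> {local_radius r lam L (d k i) (m k), global_radius r lam L n}" "1 \<le> a" "a \<le> b" "b \<le> n" for x a b
        using dev \<omega> inX[OF that(1)] that(2-4) by blast
    qed (use assms(2,3) lam L r growth lam_m[OF k] r_n piece[OF k] i in \<open>auto simp: d_def\<close>)
    have "(\<Sum>i = 1..n. \<bar>\<theta>h \<omega> i - \<theta>s i\<bar>\<^sup>2) = (\<Sum>k=1..K. \<Sum>i\<in>{\<nu> k..<\<nu> (k + 1)}. (\<theta>h \<omega> i - \<theta>s i)\<^sup>2)"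
      unfolding sum_over_pieces[OF pc] by simp
    also have "\<dots> \<le> (\<Sum>k=1..K. 16 * r / L\<^sup>2 * V\<^sup>2 + real (m k) * (r\<^sup>2 / (4 * L\<^sup>2 * lam\<^sup>2))
      + 16 * r / L\<^sup>2 * (1 + ln (real (m k) / 2)) + 16 * lam\<^sup>2 / L\<^sup>2 * (1 / real (m k)))"
    proof (rule sum_mono)
      fix k assume k: "k \<in> {1..K}"
      show "(\<Sum>i\<in>{\<nu> k..<\<nu> (k + 1)}. (\<theta>h \<omega> i - \<theta>s i)\<^sup>2) \<le> 16 * r / L\<^sup>2 * V\<^sup>2 + real (m k) * (r\<^sup>2 / (4 * L\<^sup>2 * lam\<^sup>2))
      + 16 * r / L\<^sup>2 * (1 + ln (real (m k) / 2)) + 16 * lam\<^sup>2 / L\<^sup>2 * (1 / real (m k))"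
        using pointwise[OF k] by (intro piece_error_le L lam r piece(4)[OF k] m2[OF k]) (auto simp: d_def)
    qed
    also have "\<dots> = 16 * r / L\<^sup>2 * V\<^sup>2 * real K + real n * (r\<^sup>2 / (4 * L\<^sup>2 * lam\<^sup>2))
      + 16 * r / L\<^sup>2 * (real K + (\<Sum>k=1..K. ln (real (m k) / 2))) + 16 * lam\<^sup>2 / L\<^sup>2 * (\<Sum>k=1..K. 1 / real (m k))"
      unfolding sum.distrib sum_distrib_left[symmetric] sum_distrib_right[symmetric] sum_m by (simp add: mult.commute)
    \<comment> \<open>The terms correspond in order: points near a jump, inner runs, runs sharing one end with
      the piece, and runs that fill the piece.\<close>
    also have "\<dots> \<le> ?T5 + ?T2 + ?T1 + ?T4"
    proof (intro add_mono)
      have "16 * r / L\<^sup>2 * V\<^sup>2 * real K = 2 * real K * (12 / L\<^sup>2 * u) * V\<^sup>2" by (simp add: r_def)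
      also have "\<dots> \<le> ?T5"
      proof (intro mult_right_mono mult_left_mono)
        have "12 / L\<^sup>2 * u \<le> 12\<^sup>2 / (2 * L\<^sup>2) * u" using u L by (intro mult_right_mono) (auto simp: field_simps)
        also have "\<dots> \<le> Max {3, 12 ^ 4 / L ^ 4, 12\<^sup>2 / (2 * L\<^sup>2) * u}" by (rule Max_ge) auto
        finally show "12 / L\<^sup>2 * u \<le> Max {3, 12 ^ 4 / L ^ 4, 12\<^sup>2 / (2 * L\<^sup>2) * u}" .
      qed auto
      finally show "16 * r / L\<^sup>2 * V\<^sup>2 * real K \<le> ?T5" .
      have "r\<^sup>2 / 4 \<le> 12 * (w\<^sup>2 + u\<^sup>2)" by (simp add: r_def power2_eq_square)
      then have "real n / (L\<^sup>2 * lam\<^sup>2) * (r\<^sup>2 / 4) \<le> real n / (L\<^sup>2 * lam\<^sup>2) * (12 * (w\<^sup>2 + u\<^sup>2))"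
        by (intro mult_left_mono) auto
      then show "real n * (r\<^sup>2 / (4 * L\<^sup>2 * lam\<^sup>2)) \<le> ?T2" by (simp add: mult_ac)
      have "0 \<le> (\<Sum>k=1..K. ln (real (m k) / 2))" using m2 by (intro sum_nonneg) fastforce
      then show "16 * r / L\<^sup>2 * (real K + (\<Sum>k=1..K. ln (real (m k) / 2))) \<le> ?T1"
        using w u by (intro mult_right_mono) (auto simp: r_def divide_right_mono)
      show "16 * lam\<^sup>2 / L\<^sup>2 * (\<Sum>k=1..K. 1 / real (m k)) \<le> ?T4"
        by (intro mult_right_mono sum_nonneg divide_right_mono) auto
    qed
    also have "\<dots> \<le> ?T1 + ?T2 + ?T3 + ?T4 + ?T5"
    proof -
      have "0 \<le> ?T3" using u by simp
      then show ?thesis by linarith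
    qed
    finally show ?thesis .
  qed
  show ?thesis
    using A(1) prob_A err_bound unfolding u_def w_def by blast
qed

end
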